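(* Let $p,q\in(1,\infty)$. Let $X$ be a Banach space that is sphere equivalent to a uniformly convex Banach space, and let $\{G_n\}_{n\in\mathbb{N}}$ be a sequence of finite connected graphs. Then $\{G_n\}_n$ is a family of $(X,p)$-anders if and only if it is a family of $(X,q)$-anders.
   Context: Graphs $G=(V,E)$ are finite, connected, undirected, possibly with multiple edges and self-loops, with at least two vertices; $E$ is the set of oriented edges. The degree of $v$ is the number of oriented edges $e=(v,w)\in E$ starting at $v$; $\Delta(G)$ is the maximal degree; $G$ carries the path metric, and $\mathrm{diam}(G)$ is its diameter. Banach spaces are nonzero. For a Banach space $X$ and $p\in[1,\infty)$, the $(X,p)$-spectral gap is $$\lambda_1(G;X,p):=\frac12\inf_{f}\frac{\sum_{v\in V}\sum_{e=(v,w)\in E}\|f(w)-f(v)\|^p}{\sum_{v\in V}\|f(v)-m(f)\|^p},\qquad m(f):=\frac1{|V|}\sum_{v\in V}f(v),$$ where $f$ runs over all nonconstant maps $f\colon V\to X$. A sequence $\{G_n\}_n$ of finite connected graphs is a family of $(X,p)$-anders if $\sup_n\Delta(G_n)<\infty$, $\lim_{n\to\infty}\mathrm{diam}(G_n)=\infty$, and $\inf_n\lambda_1(G_n;X,p)>0$. $S(X)$ denotes the unit sphere of $X$. Two Banach spaces $X,Y$ are sphere equivalent if there is a uniform homeomorphism $S(X)\to S(Y)$ (a bijection uniformly continuous in both directions). A Banach space $X$ is uniformly convex if for every $\epsilon\in(0,2]$, $\sup\{\|x+y\|/2 : x,y\in S(X),\ \|x-y\|\ge\epsilon\}<1$. 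*)

theory Defs
  imports
    "HOL-Analysis.Analysis"
    "Graph_Theory.Digraph_Component"
    "Graph_Theory.Shortest_Path"
begin

text \<open>
  The arcs of a graph are its oriented edges. That the underlying graph is undirected, with
  multiplicities, is expressed by an involution reversing the orientation; the library predicate
  \<^const>\<open>symmetric\<close> would not force the numbers of arcs from \<open>v\<close> to \<open>w\<close> and from \<open>w\<close> to \<open>v\<close> to agree.
  The involution may fix loops, so a self-loop may be present with one or with two orientations.
\<close>

definition finite_connected_graph :: "('v, 'e) pre_digraph \<Rightarrow> bool" where
  "finite_connected_graph G \<longleftrightarrow>
     fin_digraph G \<and> Digraph_Component.connected G \<and> card (verts G) \<ge> 2 \<and>
     (\<exists>r. \<forall>e \<in> arcs G. r e \<in> arcs G \<and> r (r e) = e \<and>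
            tail G (r e) = head G e \<and> head G (r e) = tail G e)"

definition max_degree :: "('v, 'e) pre_digraph \<Rightarrow> nat" where
  "max_degree G = Max (out_degree G ` verts G)"

definition path_dist :: "('v, 'e) pre_digraph \<Rightarrow> 'v \<Rightarrow> 'v \<Rightarrow> ereal" where
  "path_dist G u v = wf_digraph.\<mu> G (\<lambda>_. 1) u v"

definition graph_diam :: "('v, 'e) pre_digraph \<Rightarrow> ereal" where
  "graph_diam G = (SUP u \<in> verts G. SUP v \<in> verts G. path_dist G u v)"

definition vertex_mean :: "('v, 'e) pre_digraph \<Rightarrow> ('v \<Rightarrow> 'x::real_vector) \<Rightarrow> 'x" where
  "vertex_mean G f = (1 / real (card (verts G))) *\<^sub>R (\<Sum>v \<in> verts G. f v)"

text \<open>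
  Maps on the vertex set are total functions on the vertex type; only their values on
  \<open>verts G\<close> enter.
\<close>

definition spectral_gap ::
  "('v, 'e) pre_digraph \<Rightarrow> 'x::real_normed_vector itself \<Rightarrow> real \<Rightarrow> real" where
  "spectral_gap G X p =
     1 / 2 * (INF f \<in> {f :: 'v \<Rightarrow> 'x. \<not> f constant_on verts G}.
       (\<Sum>v \<in> verts G. \<Sum>e \<in> out_arcs G v. norm (f (head G e) - f v) powr p) /
       (\<Sum>v \<in> verts G. norm (f v - vertex_mean G f) powr p))"

definition anders ::
  "(nat \<Rightarrow> ('v, 'e) pre_digraph) \<Rightarrow> 'x::real_normed_vector itself \<Rightarrow> real \<Rightarrow> bool" where
  "anders G X p \<longleftrightarrow>
     (SUP n. enat (max_degree (G n))) < \<infinity> \<and>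
     (\<lambda>n. graph_diam (G n)) \<longlonglongrightarrow> \<infinity> \<and>
     (INF n. spectral_gap (G n) X p) > 0"

definition sphere_equivalent ::
  "'x::real_normed_vector itself \<Rightarrow> 'y::real_normed_vector itself \<Rightarrow> bool" where
  "sphere_equivalent X Y \<longleftrightarrow>
     (\<exists>(f :: 'x \<Rightarrow> 'y) g. homeomorphism (sphere 0 1) (sphere 0 1) f g \<and>
        uniformly_continuous_on (sphere 0 1) f \<and> uniformly_continuous_on (sphere 0 1) g)"

definition uniformly_convex :: "'x::real_normed_vector itself \<Rightarrow> bool" where
  "uniformly_convex X \<longleftrightarrow>
     (\<forall>\<epsilon> \<in> {0<..2}.
        (SUP (x, y) \<in> {(x :: 'x, y). x \<in> sphere 0 1 \<and> y \<in> sphere 0 1 \<and> norm (x - y) \<ge> \<epsilon>}.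
           norm (x + y) / 2) < 1)"

end

theory Submission
  imports Defs
begin

text \<open>
  Fix exponents \<open>p\<close>, \<open>q\<close> and put \<open>\<alpha> = p / q\<close>. The Mazur map \<open>M\<^sub>\<alpha> x = \<parallel>x\<parallel>\<^sup>\<alpha>\<^sup>-\<^sup>1 x\<close>, applied at each
  vertex, carries \<open>\<ell>\<^sub>p(V, X)\<close> to \<open>\<ell>\<^sub>q(V, X)\<close> with \<open>\<Sum>\<parallel>M\<^sub>\<alpha> f\<parallel>\<^sup>q = \<Sum>\<parallel>f\<parallel>\<^sup>p\<close>; its inverse is the Mazur map with
  exponent \<open>1 / \<alpha>\<close>, and it takes constant maps to constant maps. It is uniformly continuous on
  bounded sets, with a modulus that does not depend on the number of vertices, because of the
  pointwise estimate
  \<open>\<parallel>M\<^sub>\<alpha> a - M\<^sub>\<alpha> b\<parallel>\<^sup>q \<le> \<eta> \<parallel>a\<parallel>\<^sup>p + C \<parallel>a - b\<parallel>\<^sup>p\<close> with \<open>\<eta>\<close> as small as desired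
  (lemma \<open>mazur_map_modulus\<close>).

  A lower bound on the spectral gap is the same as a Poincare inequality
  \<open>\<Sum>\<parallel>f - m(f)\<parallel>\<^sup>p \<le> A \<E>\<^sub>p(f)\<close>, where \<open>\<E>\<^sub>p\<close> is the sum of \<open>\<parallel>f(w) - f(v)\<parallel>\<^sup>p\<close> over the arcs. Suppose it
  holds with exponent \<open>q\<close>, and let \<open>f\<close> have mean zero and small \<open>\<E>\<^sub>p(f)\<close> compared with
  \<open>\<Sum>\<parallel>f\<parallel>\<^sup>p\<close>. Applied to the two ends of each arc, the pointwise estimate shows that \<open>g = M\<^sub>\<alpha> f\<close> has small
  \<open>\<E>\<^sub>q(g)\<close>; this is where the degree bound enters, since \<open>\<parallel>f(v)\<parallel>\<^sup>p\<close> is counted once for each arc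
  starting at \<open>v\<close>. The Poincare inequality makes \<open>g\<close> close to a constant, and the pointwise estimate
  for the inverse map then makes \<open>f\<close> close to a constant. But a map of mean zero stays away from all
  constants, at a distance comparable to its own norm. All of these inequalities are homogeneous, so
  they combine into a Poincare inequality with exponent \<open>p\<close> whose constant depends only on \<open>p\<close>, \<open>q\<close>,
  \<open>A\<close> and the degree bound (lemma \<open>poincare_change_exponent\<close>). Since the degrees and the diameters in
  the notion of anders do not refer to the exponent, this proves the theorem.
\<close>

section \<open>The Mazur map\<close>

definition mazur_map :: "real \<Rightarrow> 'x::real_normed_vector \<Rightarrow> 'x" where
  "mazur_map \<alpha> x = norm x powr (\<alpha> - 1) *\<^sub>R x"

lemma norm_mazur_map: "norm (mazur_map \<alpha> x) = norm x powr \<alpha>"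
proof (cases "x = 0")
  case False
  then have "norm x powr (\<alpha> - 1) * norm x powr 1 = norm x powr \<alpha>"
    by (simp only: powr_add [symmetric]) simp
  with False show ?thesis by (simp add: mazur_map_def)
qed (simp add: mazur_map_def)

lemma mazur_map_inverse:
  assumes "\<alpha> \<noteq> 0"
  shows "mazur_map (1 / \<alpha>) (mazur_map \<alpha> x) = x"
proof (cases "x = 0")
  case False
  have "\<alpha> * (1 / \<alpha> - 1) + (\<alpha> - 1) = 0"
    using assms by (simp add: field_simps)
  then have "(norm x powr \<alpha>) powr (1 / \<alpha> - 1) * norm x powr (\<alpha> - 1) = 1"
    using False by (simp add: powr_powr powr_add [symmetric])
  then show ?thesis
    unfolding mazur_map_def [of "1 / \<alpha>"] norm_mazur_map
    by (simp add: mazur_map_def)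
qed (simp add: mazur_map_def)

text \<open>
  If \<open>b\<close> is relatively far from \<open>a\<close>, say \<open>\<parallel>a - b\<parallel> \<ge> s \<parallel>a\<parallel>\<close>, both images are bounded by multiples of
  \<open>\<parallel>a - b\<parallel>\<^sup>\<alpha>\<close>, and the second summand suffices. Otherwise \<open>r = \<parallel>b\<parallel> / \<parallel>a\<parallel>\<close> is within \<open>s\<close> of \<open>1\<close>, and
  the difference of the images is at most \<open>\<parallel>a\<parallel>\<^sup>\<alpha> (s + \<bar>r - r\<^sup>\<alpha>\<bar>)\<close>, where the bracket tends to \<open>0\<close>
  with \<open>s\<close>. Only \<open>\<parallel>a\<parallel>\<close> and not \<open>\<parallel>b\<parallel>\<close> occurs in the bound, so that along an arc it is enough to control
  the value at the tail.
\<close>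

lemma mazur_map_modulus:
  fixes p q \<eta> :: real
  assumes "0 < p" "0 < q" "0 < \<eta>"
  obtains C where "0 < C"
    and "\<And>a b :: 'x::real_normed_vector.
      norm (mazur_map (p / q) a - mazur_map (p / q) b) powr q
        \<le> \<eta> * norm a powr p + C * norm (a - b) powr p"
proof -
  define \<alpha> where "\<alpha> = p / q"
  have \<alpha>: "0 < \<alpha>" "\<alpha> * q = p" using assms by (auto simp: \<alpha>_def)
  define \<tau> where "\<tau> = \<eta> powr (1 / q)"
  have \<tau>: "0 < \<tau>" "\<tau> powr q = \<eta>"
    using assms by (auto simp: \<tau>_def powr_powr)
  have "isCont (\<lambda>r::real. \<bar>r - r powr \<alpha>\<bar>) 1"
    by (intro continuous_intros) auto
  moreover have "0 < \<tau> / 2" using \<tau>(1) by simp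
  ultimately obtain s0 where "0 < s0"
    "\<And>r. dist r 1 < s0 \<Longrightarrow> dist \<bar>r - r powr \<alpha>\<bar> \<bar>1 - 1 powr \<alpha>\<bar> < \<tau> / 2"
    unfolding continuous_at_eps_delta by meson
  then have s0: "0 < s0" "\<And>r. \<bar>r - 1\<bar> < s0 \<Longrightarrow> \<bar>r - r powr \<alpha>\<bar> < \<tau> / 2"
    by (simp_all add: dist_real_def)
  define s where "s = min s0 (min (1 / 2) (\<tau> / 2))"
  have s: "0 < s" "s \<le> s0" "s < 1" "s \<le> \<tau> / 2" using s0(1) \<tau>(1) by (auto simp: s_def)
  define B where "B = (1 / s) powr \<alpha> + (1 + 1 / s) powr \<alpha>"
  have B: "0 < B" using s(1) unfolding B_def by (intro add_pos_nonneg) auto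
  show thesis
  proof (rule that [of "B powr q"])
    show "0 < B powr q" using B by simp
    fix a b :: 'x
    show "norm (mazur_map (p / q) a - mazur_map (p / q) b) powr q
        \<le> \<eta> * norm a powr p + B powr q * norm (a - b) powr p"
    proof (cases "s * norm a \<le> norm (a - b)")
      case True
      have a: "norm a \<le> (1 / s) * norm (a - b)" using True s(1) by (simp add: field_simps)
      have b: "norm b \<le> (1 + 1 / s) * norm (a - b)"
        using a norm_triangle_ineq2 [of b a]
        by (simp add: algebra_simps norm_minus_commute [of b a])
      have "norm (mazur_map \<alpha> a - mazur_map \<alpha> b) \<le> norm a powr \<alpha> + norm b powr \<alpha>"
        using norm_triangle_ineq4 [of "mazur_map \<alpha> a" "mazur_map \<alpha> b"] by (simp add: norm_mazur_map)
      also have "\<dots> \<le> ((1 / s) * norm (a - b)) powr \<alpha> + ((1 + 1 / s) * norm (a - b)) powr \<alpha>"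
        using a b \<alpha>(1) by (intro add_mono powr_mono2) auto
      also have "\<dots> = B * norm (a - b) powr \<alpha>"
        unfolding B_def using s(1) by (subst (1 2) powr_mult) (auto simp: algebra_simps)
      finally have "norm (mazur_map \<alpha> a - mazur_map \<alpha> b) powr q \<le> (B * norm (a - b) powr \<alpha>) powr q"
        using assms(2) by (intro powr_mono2) auto
      also have "\<dots> = B powr q * norm (a - b) powr p"
        using B \<alpha>(2) by (simp add: powr_mult powr_powr)
      finally show ?thesis using assms(3) by (simp add: \<alpha>_def add_increasing)
    next
      case False
      then have near: "norm (a - b) < s * norm a" by simp
      then have a: "0 < norm a"
        by (cases "a = 0") auto
      define r where "r = norm b / norm a"
      have nb: "norm b = r * norm a" using a by (simp add: r_def)
      have "\<bar>norm b - norm a\<bar> < s * norm a"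
        using near norm_triangle_ineq3 [of b a] by (simp add: norm_minus_commute [of b a])
      then have "\<bar>r - 1\<bar> * norm a < s * norm a"
        using a by (simp add: nb abs_mult [symmetric] left_diff_distrib abs_mult_pos)
      then have r: "\<bar>r - 1\<bar> < s" using a by simp
      then have "0 < r" using s(3) by linarith
      have pw: "norm x powr (\<alpha> - 1) * norm x = norm x powr \<alpha>" for x :: 'x
        using norm_mazur_map [of \<alpha> x] by (simp add: mazur_map_def)
      have b1: "norm a powr (\<alpha> - 1) * norm b = norm a powr \<alpha> * r"
        unfolding nb using pw [of a] by (metis mult.assoc mult.commute)
      have b2: "norm b powr \<alpha> = norm a powr \<alpha> * r powr \<alpha>"
        unfolding nb using a \<open>0 < r\<close> by (simp add: powr_mult)
      have "mazur_map \<alpha> a - mazur_map \<alpha> b =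
          norm a powr (\<alpha> - 1) *\<^sub>R (a - b) + (norm a powr (\<alpha> - 1) - norm b powr (\<alpha> - 1)) *\<^sub>R b"
        by (simp add: mazur_map_def algebra_simps)
      then have "norm (mazur_map \<alpha> a - mazur_map \<alpha> b)
          \<le> norm a powr (\<alpha> - 1) * norm (a - b)
            + \<bar>norm a powr (\<alpha> - 1) - norm b powr (\<alpha> - 1)\<bar> * norm b"
        using norm_triangle_ineq [of "norm a powr (\<alpha> - 1) *\<^sub>R (a - b)"
            "(norm a powr (\<alpha> - 1) - norm b powr (\<alpha> - 1)) *\<^sub>R b"] by simp
      also have "\<dots> \<le> norm a powr (\<alpha> - 1) * (s * norm a) + norm a powr \<alpha> * \<bar>r - r powr \<alpha>\<bar>"
      proof (intro add_mono mult_left_mono)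
        have "\<bar>norm a powr (\<alpha> - 1) - norm b powr (\<alpha> - 1)\<bar> * norm b
            = \<bar>norm a powr (\<alpha> - 1) * norm b - norm b powr (\<alpha> - 1) * norm b\<bar>"
          by (simp add: abs_mult_pos left_diff_distrib)
        also have "\<dots> = \<bar>norm a powr \<alpha> * r - norm a powr \<alpha> * r powr \<alpha>\<bar>"
          by (simp only: pw b1 b2)
        also have "\<dots> = norm a powr \<alpha> * \<bar>r - r powr \<alpha>\<bar>"
          by (simp add: right_diff_distrib [symmetric] abs_mult)
        finally show "\<bar>norm a powr (\<alpha> - 1) - norm b powr (\<alpha> - 1)\<bar> * norm b
            \<le> norm a powr \<alpha> * \<bar>r - r powr \<alpha>\<bar>" by simp
      qed (use near in auto)
      also have "\<dots> = norm a powr \<alpha> * (s + \<bar>r - r powr \<alpha>\<bar>)"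
        using pw [of a] by (metis distrib_left mult.commute mult.left_commute)
      also have "\<dots> \<le> norm a powr \<alpha> * \<tau>"
        using s0(2) [of r] r s(2,4) by (intro mult_left_mono) auto
      finally have "norm (mazur_map \<alpha> a - mazur_map \<alpha> b) powr q \<le> (norm a powr \<alpha> * \<tau>) powr q"
        using assms(2) by (intro powr_mono2) auto
      also have "\<dots> = \<eta> * norm a powr p"
        using \<tau> \<alpha>(2) by (simp add: powr_mult powr_powr)
      finally show ?thesis by (simp add: \<alpha>_def add_increasing2)
    qed
  qed
qed

section \<open>Means and distances to constants\<close>

lemma powr_add_le:
  fixes x y p :: real
  assumes "0 \<le> x" "0 \<le> y" "0 < p"
  shows "(x + y) powr p \<le> 2 powr p * (x powr p + y powr p)"
proof -
  have "(x + y) powr p \<le> (2 * max x y) powr p"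
    using assms by (intro powr_mono2) auto
  also have "\<dots> = 2 powr p * max x y powr p"
    using assms by (simp add: powr_mult)
  also have "\<dots> \<le> 2 powr p * (x powr p + y powr p)"
    by (intro mult_left_mono) (auto simp: max_def)
  finally show ?thesis .
qed

lemma convex_on_powr_nonneg:
  assumes "1 \<le> p"
  shows "convex_on {0..} (\<lambda>x::real. x powr p)"
proof (rule convex_on_linorderI)
  fix t x y :: real
  assume t: "0 < t" "t < 1" and xy: "x \<in> {0..}" "y \<in> {0..}" "x < y"
  show "((1 - t) *\<^sub>R x + t *\<^sub>R y) powr p \<le> (1 - t) * x powr p + t * y powr p"
  proof (cases "x = 0")
    case True
    have "t powr p \<le> t powr 1" using t assms by (intro powr_mono') auto
    then show ?thesis using True t xy by (simp add: powr_mult mult_right_mono)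
  next
    case False
    then show ?thesis
      using convex_onD [OF powr_convex [OF assms], of t x y] t xy by simp
  qed
qed simp

text \<open>This is Jensen's inequality: taking means is a contraction of \<open>\<ell>\<^sub>p(V, X)\<close>.\<close>

lemma norm_vertex_mean_powr_le:
  fixes u :: "'v \<Rightarrow> 'x::real_normed_vector"
  assumes "1 \<le> p" "finite (verts G)" "verts G \<noteq> {}"
  shows "real (card (verts G)) * norm (vertex_mean G u) powr p \<le> (\<Sum>v\<in>verts G. norm (u v) powr p)"
proof -
  define n where "n = real (card (verts G))"
  have n: "0 < n" using assms by (simp add: n_def card_gt_0_iff)
  have "norm (vertex_mean G u) \<le> (\<Sum>v\<in>verts G. (1 / n) * norm (u v))"
    unfolding vertex_mean_def n_def [symmetric]
    using n norm_sum [of u "verts G"]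
    by (simp add: sum_divide_distrib [symmetric] divide_right_mono)
  then have "norm (vertex_mean G u) powr p \<le> (\<Sum>v\<in>verts G. (1 / n) *\<^sub>R norm (u v)) powr p"
    using assms(1) by (intro powr_mono2) auto
  also have "\<dots> \<le> (\<Sum>v\<in>verts G. (1 / n) * norm (u v) powr p)"
    using assms n convex_on_powr_nonneg [of p]
    by (intro convex_on_sum [where f = "\<lambda>x. x powr p" and C = "{0..}"]) (auto simp: n_def)
  finally show ?thesis
    using n by (simp add: n_def [symmetric] sum_divide_distrib [symmetric] field_simps)
qed

text \<open>
  Subtracting the mean is an operator of norm at most \<open>2\<close> on \<open>\<ell>\<^sub>p(V, X)\<close> that kills the constant
  maps, so it takes \<open>f - c\<close> back to \<open>f\<close> when \<open>f\<close> has mean zero.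
\<close>

lemma mean_zero_far_from_constants:
  fixes f :: "'v \<Rightarrow> 'x::real_normed_vector"
  assumes "1 \<le> p" "finite (verts G)" "verts G \<noteq> {}" "vertex_mean G f = 0"
  shows "(\<Sum>v\<in>verts G. norm (f v) powr p) \<le> 2 * 2 powr p * (\<Sum>v\<in>verts G. norm (f v - c) powr p)"
proof -
  have m: "vertex_mean G (\<lambda>v. f v - c) = - c"
    using assms(2-4) by (simp add: vertex_mean_def sum_subtractf scaleR_diff_right sum_constant_scaleR
        card_gt_0_iff)
  have "(\<Sum>v\<in>verts G. norm (f v) powr p)
      \<le> (\<Sum>v\<in>verts G. 2 powr p * (norm (f v - c) powr p + norm c powr p))"
  proof (intro sum_mono)
    fix v
    have "norm (f v) powr p \<le> (norm (f v - c) + norm c) powr p"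
      using norm_triangle_ineq [of "f v - c" c] assms(1) by (intro powr_mono2) auto
    also have "\<dots> \<le> 2 powr p * (norm (f v - c) powr p + norm c powr p)"
      using assms(1) by (intro powr_add_le) auto
    finally show "norm (f v) powr p \<le> 2 powr p * (norm (f v - c) powr p + norm c powr p)" .
  qed
  also have "\<dots> = 2 powr p * ((\<Sum>v\<in>verts G. norm (f v - c) powr p)
      + real (card (verts G)) * norm (vertex_mean G (\<lambda>v. f v - c)) powr p)"
    by (simp add: m sum_distrib_left [symmetric] sum.distrib)
  also have "\<dots> \<le> 2 powr p * ((\<Sum>v\<in>verts G. norm (f v - c) powr p)
      + (\<Sum>v\<in>verts G. norm (f v - c) powr p))"
    using norm_vertex_mean_powr_le [OF assms(1-3)] by (intro mult_left_mono add_left_mono) auto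
  finally show ?thesis by simp
qed

section \<open>Poincare inequalities and the spectral gap\<close>

definition arc_energy ::
  "('v, 'e) pre_digraph \<Rightarrow> real \<Rightarrow> ('v \<Rightarrow> 'x::real_normed_vector) \<Rightarrow> real" where
  "arc_energy G p f = (\<Sum>v\<in>verts G. \<Sum>e\<in>out_arcs G v. norm (f (head G e) - f v) powr p)"

definition poincare ::
  "('v, 'e) pre_digraph \<Rightarrow> 'x::real_normed_vector itself \<Rightarrow> real \<Rightarrow> real \<Rightarrow> bool" where
  "poincare G X p A \<longleftrightarrow>
     (\<forall>f :: 'v \<Rightarrow> 'x. (\<Sum>v\<in>verts G. norm (f v - vertex_mean G f) powr p) \<le> A * arc_energy G p f)"

lemma arc_energy_nonneg: "0 \<le> arc_energy G p f"
  unfolding arc_energy_def by (intro sum_nonneg) auto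

lemma finite_connected_graph_verts:
  assumes "finite_connected_graph G"
  shows "finite (verts G)" "2 \<le> card (verts G)" "verts G \<noteq> {}"
  using assms by (auto simp: finite_connected_graph_def fin_digraph.finite_verts)

lemma out_degree_le_max_degree:
  assumes "finite_connected_graph G" "v \<in> verts G"
  shows "out_degree G v \<le> max_degree G"
  using assms(2) finite_connected_graph_verts [OF assms(1)] by (auto simp: max_degree_def)

lemma deviation_pos_if_not_constant:
  assumes "finite (verts G)" "\<not> f constant_on verts G"
  shows "0 < (\<Sum>v\<in>verts G. norm (f v - vertex_mean G f) powr p)"
proof -
  obtain v where "v \<in> verts G" "f v \<noteq> vertex_mean G f"
    using assms(2) by (auto simp: constant_on_def)
  then show ?thesis using assms(1) by (intro sum_pos2 [of _ v]) auto
qed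

lemma ex_not_constant_on:
  fixes V :: "'v set"
  assumes "2 \<le> card V" "(UNIV :: 'x::real_vector set) \<noteq> {0}"
  shows "\<exists>f :: 'v \<Rightarrow> 'x. \<not> f constant_on V"
proof -
  obtain z :: 'x where z: "z \<noteq> 0" using assms(2) by auto
  obtain u v where "u \<in> V" "v \<in> V" "u \<noteq> v"
    using assms(1) card_le_Suc0_iff_eq [of V] card.infinite [of V] by fastforce
  then have "\<not> (\<lambda>w. if w = u then z else 0) constant_on V"
    using z unfolding constant_on_def by metis
  then show ?thesis by blast
qed

lemma bdd_below_rayleigh_quotients:
  "bdd_below ((\<lambda>f :: 'v \<Rightarrow> 'x::real_normed_vector. arc_energy G p f /
      (\<Sum>v\<in>verts G. norm (f v - vertex_mean G f) powr p)) ` S)"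
  by (intro bdd_belowI2 [of _ 0] divide_nonneg_nonneg arc_energy_nonneg sum_nonneg) auto

lemma poincare_if_spectral_gap:
  fixes X :: "'x::real_normed_vector itself" and G :: "('v, 'e) pre_digraph"
  assumes "finite (verts G)" "0 < \<gamma>" "\<gamma> \<le> spectral_gap G X p"
  shows "poincare G X p (1 / (2 * \<gamma>))"
  unfolding poincare_def
proof
  fix f :: "'v \<Rightarrow> 'x"
  let ?S = "\<Sum>v\<in>verts G. norm (f v - vertex_mean G f) powr p"
  show "?S \<le> 1 / (2 * \<gamma>) * arc_energy G p f"
  proof (cases "f constant_on verts G")
    case True
    then obtain c where c: "\<forall>v\<in>verts G. f v = c" by (auto simp: constant_on_def)
    then have "\<forall>v\<in>verts G. f v = vertex_mean G f"
      using assms(1) by (auto simp: vertex_mean_def sum_constant_scaleR)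
    then have "?S = 0" by (intro sum.neutral) simp
    then show ?thesis using assms(2) arc_energy_nonneg [of G p f] by simp
  next
    case False
    have "2 * spectral_gap G X p \<le> arc_energy G p f / ?S"
      unfolding spectral_gap_def arc_energy_def [symmetric]
      using False cINF_lower [OF bdd_below_rayleigh_quotients [of G p], of f] by simp
    with assms(3) have "2 * \<gamma> \<le> arc_energy G p f / ?S" by linarith
    then show ?thesis
      using assms(2) deviation_pos_if_not_constant [OF assms(1) False, of p]
      by (simp add: field_simps)
  qed
qed

lemma spectral_gap_ge_if_poincare:
  fixes X :: "'x::real_normed_vector itself"
  assumes "finite_connected_graph G" "(UNIV :: 'x set) \<noteq> {0}" "0 < A" "poincare G X p A"
  shows "1 / (2 * A) \<le> spectral_gap G X p"
proof -
  note V = finite_connected_graph_verts [OF assms(1)]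
  have "1 / A \<le> (INF f \<in> {f :: 'a \<Rightarrow> 'x. \<not> f constant_on verts G}. arc_energy G p f /
      (\<Sum>v\<in>verts G. norm (f v - vertex_mean G f) powr p))"
  proof (rule cINF_greatest)
    show "{f :: 'a \<Rightarrow> 'x. \<not> f constant_on verts G} \<noteq> {}"
      using ex_not_constant_on [OF V(2) assms(2)] by auto
    fix f :: "'a \<Rightarrow> 'x" assume "f \<in> {f. \<not> f constant_on verts G}"
    then have "0 < (\<Sum>v\<in>verts G. norm (f v - vertex_mean G f) powr p)"
      using deviation_pos_if_not_constant [OF V(1)] by auto
    moreover have "(\<Sum>v\<in>verts G. norm (f v - vertex_mean G f) powr p) \<le> A * arc_energy G p f"
      using assms(4) by (auto simp: poincare_def)
    ultimately show "1 / A \<le> arc_energy G p f / (\<Sum>v\<in>verts G. norm (f v - vertex_mean G f) powr p)"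
      using assms(3) by (simp add: field_simps)
  qed
  then show ?thesis by (simp add: spectral_gap_def arc_energy_def)
qed

lemma spectral_gap_nonneg:
  fixes X :: "'x::real_normed_vector itself"
  assumes "finite_connected_graph G" "(UNIV :: 'x set) \<noteq> {0}"
  shows "0 \<le> spectral_gap G X p"
proof -
  have "0 \<le> (INF f \<in> {f :: 'a \<Rightarrow> 'x. \<not> f constant_on verts G}. arc_energy G p f /
      (\<Sum>v\<in>verts G. norm (f v - vertex_mean G f) powr p))"
    using ex_not_constant_on [OF finite_connected_graph_verts(2) [OF assms(1)] assms(2)]
    by (intro cINF_greatest divide_nonneg_nonneg arc_energy_nonneg sum_nonneg) auto
  then show ?thesis by (simp add: spectral_gap_def arc_energy_def)
qed

text \<open>
  Only positivity of the infimum matters for anders, and in terms of a common constant it no longer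
  involves quotients: nonconstant maps need not be singled out.
\<close>

lemma INF_spectral_gap_pos_iff_poincare:
  fixes X :: "'x::real_normed_vector itself" and G :: "nat \<Rightarrow> ('v, 'e) pre_digraph"
  assumes "\<And>n. finite_connected_graph (G n)" "(UNIV :: 'x set) \<noteq> {0}"
  shows "0 < (INF n. spectral_gap (G n) X p) \<longleftrightarrow> (\<exists>A>0. \<forall>n. poincare (G n) X p A)"
proof
  let ?l = "INF n. spectral_gap (G n) X p"
  assume l: "0 < ?l"
  have "?l \<le> spectral_gap (G n) X p" for n
    using spectral_gap_nonneg [OF assms] by (intro cINF_lower bdd_belowI2 [of _ 0]) auto
  then have "poincare (G n) X p (1 / (2 * ?l))" for n
    using poincare_if_spectral_gap [OF finite_connected_graph_verts(1) [OF assms(1)] l] by blast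
  moreover have "0 < 1 / (2 * ?l)" using l by simp
  ultimately show "\<exists>A>0. \<forall>n. poincare (G n) X p A" by blast
next
  assume "\<exists>A>0. \<forall>n. poincare (G n) X p A"
  then obtain A where A: "0 < A" "\<And>n. poincare (G n) X p A" by blast
  have "1 / (2 * A) \<le> (INF n. spectral_gap (G n) X p)"
    using spectral_gap_ge_if_poincare [OF assms A] by (intro cINF_greatest) auto
  moreover have "0 < 1 / (2 * A)" using A(1) by simp
  ultimately show "0 < (INF n. spectral_gap (G n) X p)" by linarith
qed

section \<open>Changing the exponent\<close>

text \<open>
  The Mazur map sends a map of small relative \<open>p\<close>-energy to a map of small relative \<open>q\<close>-energy. The
  error term \<open>\<eta>\<close> is charged to the tail of each arc, hence at most \<open>D\<close> times to each vertex.
\<close>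

lemma arc_energy_mazur_map_le:
  fixes f :: "'v \<Rightarrow> 'x::real_normed_vector"
  assumes modulus: "\<And>a b :: 'x. norm (mazur_map \<alpha> a - mazur_map \<alpha> b) powr q
        \<le> \<eta> * norm a powr p + C * norm (a - b) powr p"
    and "0 \<le> \<eta>" and deg: "\<And>v. v \<in> verts G \<Longrightarrow> real (out_degree G v) \<le> D"
  shows "arc_energy G q (\<lambda>v. mazur_map \<alpha> (f v))
    \<le> D * \<eta> * (\<Sum>v\<in>verts G. norm (f v) powr p) + C * arc_energy G p f"
proof -
  have "arc_energy G q (\<lambda>v. mazur_map \<alpha> (f v))
      \<le> (\<Sum>v\<in>verts G. \<Sum>e\<in>out_arcs G v.
            \<eta> * norm (f v) powr p + C * norm (f (head G e) - f v) powr p)"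
    unfolding arc_energy_def
  proof (intro sum_mono)
    fix v e
    show "norm (mazur_map \<alpha> (f (head G e)) - mazur_map \<alpha> (f v)) powr q
        \<le> \<eta> * norm (f v) powr p + C * norm (f (head G e) - f v) powr p"
      using modulus [of "f v" "f (head G e)"] by (simp add: norm_minus_commute)
  qed
  also have "\<dots> = (\<Sum>v\<in>verts G. real (out_degree G v) * (\<eta> * norm (f v) powr p))
      + C * arc_energy G p f"
    by (simp add: arc_energy_def sum.distrib sum_distrib_left out_degree_def)
  also have "\<dots> \<le> (\<Sum>v\<in>verts G. D * (\<eta> * norm (f v) powr p)) + C * arc_energy G p f"
    using assms(2) deg by (intro add_right_mono sum_mono mult_right_mono) auto
  finally show ?thesis by (simp add: sum_distrib_left mult.assoc)
qed

lemma poincare_change_exponent: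
  fixes X :: "'x::real_normed_vector itself" and p q A D :: real
  assumes "1 < p" "1 < q" "0 < A" "0 \<le> D"
  shows "\<exists>B>0. \<forall>G :: ('v, 'e) pre_digraph.
    finite_connected_graph G \<longrightarrow> (\<forall>v\<in>verts G. real (out_degree G v) \<le> D) \<longrightarrow>
    poincare G X q A \<longrightarrow> poincare G X p B"
proof -
  define K where "K = 2 * 2 powr p"
  have K: "0 < K" by (simp add: K_def)
  \<comment> \<open>The two error terms \<open>\<eta>'\<close> and \<open>\<eta>\<close> are chosen so that together they contribute at most half of
    \<open>\<Sum>\<parallel>f\<parallel>\<^sup>p\<close> to the final estimate, where they are absorbed by the left-hand side.\<close>
  define \<eta>' where "\<eta>' = 1 / (4 * K)"
  have \<eta>': "0 < \<eta>'" "K * \<eta>' = 1 / 4" using K by (auto simp: \<eta>'_def)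
  obtain C' where C': "0 < C'" "\<And>a b :: 'x.
      norm (mazur_map (q / p) a - mazur_map (q / p) b) powr p
        \<le> \<eta>' * norm a powr q + C' * norm (a - b) powr q"
    using mazur_map_modulus [of q p \<eta>'] assms \<eta>'(1) by auto
  define \<eta> where "\<eta> = 1 / (4 * K * C' * A * (D + 1))"
  have \<eta>: "0 < \<eta>" using K C'(1) assms by (simp add: \<eta>_def)
  have "K * C' * A * (D * \<eta>) = (1 / 4) * (D / (D + 1))"
    using K C'(1) assms by (simp add: \<eta>_def)
  also have "\<dots> \<le> 1 / 4" using assms by (simp add: field_simps)
  finally have \<eta>_small: "K * C' * A * (D * \<eta>) \<le> 1 / 4" .
  obtain C where C: "0 < C" "\<And>a b :: 'x.
      norm (mazur_map (p / q) a - mazur_map (p / q) b) powr q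
        \<le> \<eta> * norm a powr p + C * norm (a - b) powr p"
    using mazur_map_modulus [of p q \<eta>] assms \<eta> by auto
  define B where "B = 2 * (K * C' * A * C)"
  show ?thesis
  proof (intro exI [of _ B] conjI allI impI)
    show "0 < B" using K C C' assms by (simp add: B_def)
    fix G :: "('v, 'e) pre_digraph"
    assume G: "finite_connected_graph G" and deg: "\<forall>v\<in>verts G. real (out_degree G v) \<le> D"
      and q: "poincare G X q A"
    note V = finite_connected_graph_verts [OF G]
    show "poincare G X p B"
      unfolding poincare_def
    proof
      fix f0 :: "'v \<Rightarrow> 'x"
      define f where "f = (\<lambda>v. f0 v - vertex_mean G f0)"
      have mean_f: "vertex_mean G f = 0"
        using V by (simp add: f_def vertex_mean_def sum_subtractf scaleR_diff_right sum_constant_scaleR)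
      define g where "g = (\<lambda>v. mazur_map (p / q) (f v))"
      define c where "c = vertex_mean G g"
      let ?S = "\<Sum>v\<in>verts G. norm (f v) powr p"
      have f_eq: "f v = mazur_map (q / p) (g v)" for v
        using mazur_map_inverse [of "p / q" "f v"] assms by (simp add: g_def)
      have norm_g: "norm (g v) powr q = norm (f v) powr p" for v
        using assms by (simp add: g_def norm_mazur_map powr_powr)
      have energy: "arc_energy G q g \<le> D * \<eta> * ?S + C * arc_energy G p f"
        unfolding g_def using \<eta> deg by (intro arc_energy_mazur_map_le [OF C(2)]) auto
      \<comment> \<open>The mean \<open>c\<close> of \<open>g\<close> is the constant that the Poincare inequality compares \<open>g\<close> with; its image
        under the inverse map is the constant to compare \<open>f\<close> with.\<close>
      have "?S \<le> K * (\<Sum>v\<in>verts G. norm (f v - mazur_map (q / p) c) powr p)"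
        unfolding K_def using assms V mean_f by (intro mean_zero_far_from_constants) auto
      also have "\<dots> \<le> K * (\<Sum>v\<in>verts G. \<eta>' * norm (f v) powr p + C' * norm (g v - c) powr q)"
      proof (intro mult_left_mono sum_mono)
        fix v
        show "norm (f v - mazur_map (q / p) c) powr p
            \<le> \<eta>' * norm (f v) powr p + C' * norm (g v - c) powr q"
          using C'(2) [of "g v" c] by (simp only: f_eq [symmetric] norm_g)
      qed (use K in simp)
      also have "\<dots> = K * \<eta>' * ?S + K * C' * (\<Sum>v\<in>verts G. norm (g v - c) powr q)"
        by (simp add: sum.distrib sum_distrib_left algebra_simps)
      also have "\<dots> \<le> K * \<eta>' * ?S + K * C' * (A * arc_energy G q g)"
        using q K C'(1) unfolding poincare_def c_def by (intro add_left_mono mult_left_mono) auto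
      also have "\<dots> \<le> K * \<eta>' * ?S + K * C' * (A * (D * \<eta> * ?S + C * arc_energy G p f))"
        using energy K C'(1) assms by (intro add_left_mono mult_left_mono) auto
      also have "\<dots> = (K * \<eta>' + K * C' * A * (D * \<eta>)) * ?S + (K * C' * A * C) * arc_energy G p f"
        by (simp add: algebra_simps)
      also have "\<dots> \<le> (1 / 2) * ?S + (K * C' * A * C) * arc_energy G p f"
        using \<eta>'(2) \<eta>_small by (intro add_right_mono mult_right_mono sum_nonneg) auto
      finally have "?S \<le> B * arc_energy G p f" by (simp add: B_def)
      moreover have "arc_energy G p f = arc_energy G p f0" by (simp add: f_def arc_energy_def)
      ultimately show "(\<Sum>v\<in>verts G. norm (f0 v - vertex_mean G f0) powr p)
          \<le> B * arc_energy G p f0"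
        by (simp add: f_def)
    qed
  qed
qed

lemma anders_change_exponent:
  fixes X :: "'x::real_normed_vector itself" and G :: "nat \<Rightarrow> ('v, 'e) pre_digraph"
  assumes "1 < p" "1 < q" "(UNIV :: 'x set) \<noteq> {0}" "\<And>n. finite_connected_graph (G n)"
    and "anders G X q"
  shows "anders G X p"
proof -
  have bounded: "(SUP n. enat (max_degree (G n))) < \<infinity>"
    and diam: "(\<lambda>n. graph_diam (G n)) \<longlonglongrightarrow> \<infinity>"
    and gap: "0 < (INF n. spectral_gap (G n) X q)"
    using assms(5) unfolding anders_def by blast+
  obtain D where D: "(SUP n. enat (max_degree (G n))) = enat D"
    using bounded by (cases "SUP n. enat (max_degree (G n))") simp_all
  have "enat (max_degree (G n)) \<le> enat D" for n
    unfolding D [symmetric] by (intro SUP_upper) auto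
  then have max_deg: "max_degree (G n) \<le> D" for n by simp
  have deg: "real (out_degree (G n) v) \<le> real D" if "v \<in> verts (G n)" for n v
    using order_trans [OF out_degree_le_max_degree [OF assms(4) that] max_deg] by simp
  obtain A where A: "0 < A" "\<And>n. poincare (G n) X q A"
    using iffD1 [OF INF_spectral_gap_pos_iff_poincare [OF assms(4,3)] gap] by (elim exE conjE) simp
  obtain B where B: "0 < B" "\<forall>H :: ('v, 'e) pre_digraph. finite_connected_graph H \<longrightarrow>
      (\<forall>v\<in>verts H. real (out_degree H v) \<le> real D) \<longrightarrow> poincare H X q A \<longrightarrow> poincare H X p B"
    using poincare_change_exponent [OF assms(1,2) A(1) of_nat_0_le_iff [of D], where X = X]
    by (elim exE conjE) (rule that)
  have "poincare (G n) X p B" for n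
    using B(2) assms(4) deg A(2) by blast
  with B(1) have "\<exists>A>0. \<forall>n. poincare (G n) X p A"
    by (intro exI [of _ B] conjI allI)
  then have "0 < (INF n. spectral_gap (G n) X p)"
    by (rule iffD2 [OF INF_spectral_gap_pos_iff_poincare [OF assms(4,3)]])
  with bounded diam show ?thesis unfolding anders_def by blast
qed

theorem theoremB:
  fixes p q :: real
    and G :: "nat \<Rightarrow> ('v, 'e) pre_digraph"
  assumes "1 < p" and "1 < q"
    and "(UNIV :: 'x::banach set) \<noteq> {0}"
    and "(UNIV :: 'y::banach set) \<noteq> {0}"
    and "uniformly_convex TYPE('y)"
    and "sphere_equivalent TYPE('x) TYPE('y)"
    and "\<And>n. finite_connected_graph (G n)"
  shows "anders G TYPE('x) p \<longleftrightarrow> anders G TYPE('x) q"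
  using anders_change_exponent [of p q G "TYPE('x)"] anders_change_exponent [of q p G "TYPE('x)"]
    assms(1-3,7) by blast

end
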